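(* Let $d\geq 2$ and consider on $\mathbb{T}^d\times[0,\infty)$ the active scalar equation $$\partial_t\theta+\boldsymbol{u}\cdot\nabla\theta=0,\qquad \nabla\cdot\boldsymbol{u}=0,\qquad \boldsymbol{u}=\boldsymbol{M}\theta,$$ where $\boldsymbol{M}$ is the Fourier multiplier operator with symbol $\boldsymbol{m}=(m_1,\dots,m_d):\mathbb{Z}^d\to\mathbb{R}^d$. Writing $\boldsymbol{k}=(\boldsymbol{k}',k_d)$ with $\boldsymbol{k}'\in\mathbb{Z}^{d-1}$, assume that for some fixed positive integer $a$: (1) $\boldsymbol{m}(\boldsymbol{0}',a)=0$ (so $\bar\theta=\sin(ax_d)$ is a steady state with velocity $0$); (2) $m_d(\boldsymbol{k})$ is a real positive rational function which is even in $\boldsymbol{k}$; (3) $m_d(\boldsymbol{k}',na)\to\infty$ as $|\boldsymbol{k}'|\to\infty$, for each fixed $n\in\mathbb{N}$; (4) $m_d(\boldsymbol{k}',na)\to 0$ as $n\to\infty$, for each fixed $\boldsymbol{k}'\in\mathbb{Z}^{d-1}$; (5) $m_d(\boldsymbol{k}',(n+1)a)<m_d(\boldsymbol{k}',na)$ for all $n\in\mathbb{N}$ and each fixed $\boldsymbol{k}'$; (6) $|\boldsymbol{m}(\boldsymbol{k})|\leq C(1+|\boldsymbol{k}|)^{r_0}$ for all $\boldsymbol{k}\in\mathbb{Z}^d$, for some $r_0\geq0$, $C>0$. Then this equation is locally Lipschitz $(H^r,H^s)$ ill-posed for any $r>\max\{2,r_0\}$ and $s\geq r+1$, i.e. it is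 not locally Lipschitz $(H^r,H^s)$ well-posed in the sense defined in the context.
   Context: Definition: let $Y\subset X\subset L^2$ be Banach spaces. The initial value problem for the equation is called locally Lipschitz $(X,Y)$ well-posed if there exist continuous functions $T:[0,\infty)^2\to(0,\infty)$, non-increasing in both variables, and $K:[0,\infty)^2\to(0,\infty)$, non-decreasing in both variables, such that for every pair of initial data $\theta^{(1)}_0,\theta^{(2)}_0\in Y$ there exist unique solutions $\theta^{(1)},\theta^{(2)}\in L^\infty(0,T;X)$ with these data satisfying $\|\theta^{(1)}(\cdot,t)-\theta^{(2)}(\cdot,t)\|_X\leq K\|\theta^{(1)}_0-\theta^{(2)}_0\|_Y$ for all $t\in[0,T]$, where $T$ and $K$ are evaluated at $(\|\theta^{(1)}_0\|_Y,\|\theta^{(2)}_0\|_Y)$.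
   Formalization: Positivity in (2) and conditions (4), (5) are required only for k' ≠ 0, since at k' = 0 they contradict m(0',a) = 0; m_d is rational off the origin, n ≥ 1, and ∇·u = 0 is read as k·m(k) = 0 for all k. *)

theory Defs
  imports "HOL-Analysis.Analysis"
begin

text \<open>
  Setting.  The torus is T^d with d = CARD('n) + 1 (so d >= 2 automatically),
  points written x = (x', x_d).  Lattice vectors k in Z^d are pairs
  (k', k_d) :: int^'n \<times> int.  A real-valued function in L^2(T^d) is
  represented by its Fourier coefficient function
  c :: (int^'n \<times> int) \<Rightarrow> complex  with c(-k) = cnj (c k),
  theta(x) = sum_k c(k) e^{i k.x}.
\<close>

type_synonym 'n lattice = "(int ^ 'n) \<times> int"
type_synonym 'n state = "'n lattice \<Rightarrow> complex"

text \<open>A lattice vector viewed as a point of R^d = real^'n \<times> real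
  (the product norm is the Euclidean norm).\<close>
definition rvec :: "'n::finite lattice \<Rightarrow> (real ^ 'n) \<times> real" where
  "rvec k = ((\<chi> i. real_of_int (fst k $ i)), real_of_int (snd k))"

definition poly_fun :: "('n::finite lattice \<Rightarrow> real) \<Rightarrow> bool" where
  "poly_fun p \<longleftrightarrow> (\<exists>(A :: ((nat ^ 'n) \<times> nat) set) coef. finite A \<and>
      (\<forall>k. p k = (\<Sum>\<alpha>\<in>A. coef \<alpha> * (\<Prod>i\<in>UNIV. real_of_int (fst k $ i) ^ (fst \<alpha> $ i))
                              * real_of_int (snd k) ^ snd \<alpha>)))"

definition real_valued :: "'n::finite state \<Rightarrow> bool" where
  "real_valued c \<longleftrightarrow> (\<forall>k. c (- k) = cnj (c k))"

definition sob_weight :: "real \<Rightarrow> 'n::finite lattice \<Rightarrow> real" where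
  "sob_weight s k = (1 + (norm (rvec k))\<^sup>2) powr s"

definition in_H :: "real \<Rightarrow> 'n::finite state \<Rightarrow> bool" where
  "in_H s c \<longleftrightarrow> real_valued c \<and> (\<lambda>k. sob_weight s k * (cmod (c k))\<^sup>2) summable_on UNIV"

definition H_norm :: "real \<Rightarrow> 'n::finite state \<Rightarrow> real" where
  "H_norm s c = sqrt (\<Sum>\<^sub>\<infinity>k. sob_weight s k * (cmod (c k))\<^sup>2)"

text \<open>Fourier multiplier symbol m :: Z^d \<rightarrow> R^d, u = M theta has coefficients m(k) c(k).
  The k-th Fourier coefficient of the nonlinearity  u.grad theta = div(u theta)
  (u divergence free) is  i sum_j (k . m(j)) c(j) c(k-j).\<close>
definition nl_summand ::
  "('n::finite lattice \<Rightarrow> (real ^ 'n) \<times> real) \<Rightarrow> 'n state \<Rightarrow> 'n lattice \<Rightarrow> 'n lattice \<Rightarrow> complex" where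
  "nl_summand m c k j = complex_of_real (inner (rvec k) (m j)) * c j * c (k - j)"

definition nonlin ::
  "('n::finite lattice \<Rightarrow> (real ^ 'n) \<times> real) \<Rightarrow> 'n state \<Rightarrow> 'n lattice \<Rightarrow> complex" where
  "nonlin m c k = \<i> * (\<Sum>\<^sub>\<infinity>j. nl_summand m c k j)"

text \<open>theta is a (weak) solution on [0,T] of
   d_t theta + u.grad theta = 0, div u = 0, u = M theta, theta(0) = theta0,
  lying in L^infinity(0,T;H^r): tested against e^{-ik.x} phi(t), i.e. for every mode k
  c_k(t) = c_k(0) - int_0^t i sum_j (k.m(j)) c_j(s) c_{k-j}(s) ds.\<close>
definition is_solution ::
  "('n::finite lattice \<Rightarrow> (real ^ 'n) \<times> real) \<Rightarrow> real \<Rightarrow> real \<Rightarrow> 'n state \<Rightarrow> (real \<Rightarrow> 'n state) \<Rightarrow> bool" where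
  "is_solution m r T theta0 theta \<longleftrightarrow>
     theta 0 = theta0 \<and>
     (\<forall>t\<in>{0..T}. in_H r (theta t)) \<and>
     (\<exists>B. \<forall>t\<in>{0..T}. H_norm r (theta t) \<le> B) \<and>
     (\<forall>t\<in>{0..T}. \<forall>k. nl_summand m (theta t) k summable_on UNIV) \<and>
     (\<forall>k. \<forall>t\<in>{0..T}.
        set_integrable lborel {0..t} (\<lambda>s. nonlin m (theta s) k) \<and>
        theta t k = theta0 k - (LINT s:{0..t}|lborel. nonlin m (theta s) k))"

definition lip_wellposed ::
  "('n::finite lattice \<Rightarrow> (real ^ 'n) \<times> real) \<Rightarrow> real \<Rightarrow> real \<Rightarrow> bool" where
  "lip_wellposed m r s \<longleftrightarrow>
     (\<exists>(T :: real \<Rightarrow> real \<Rightarrow> real) (K :: real \<Rightarrow> real \<Rightarrow> real).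
        continuous_on ({0..} \<times> {0..}) (\<lambda>(a, b). T a b) \<and>
        continuous_on ({0..} \<times> {0..}) (\<lambda>(a, b). K a b) \<and>
        (\<forall>a\<ge>0. \<forall>b\<ge>0. T a b > 0 \<and> K a b > 0) \<and>
        (\<forall>a a' b b'. 0 \<le> a \<longrightarrow> a \<le> a' \<longrightarrow> 0 \<le> b \<longrightarrow> b \<le> b' \<longrightarrow>
             T a' b' \<le> T a b \<and> K a b \<le> K a' b') \<and>
        (\<forall>theta1 theta2 :: 'n state. in_H s theta1 \<longrightarrow> in_H s theta2 \<longrightarrow>
           (let T0 = T (H_norm s theta1) (H_norm s theta2);
                K0 = K (H_norm s theta1) (H_norm s theta2)
            in (\<exists>th1. is_solution m r T0 theta1 th1 \<and>
                   (\<forall>th. is_solution m r T0 theta1 th \<longrightarrow> (\<forall>t\<in>{0..T0}. th t = th1 t))) \<and>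
               (\<exists>th2. is_solution m r T0 theta2 th2 \<and>
                   (\<forall>th. is_solution m r T0 theta2 th \<longrightarrow> (\<forall>t\<in>{0..T0}. th t = th2 t))) \<and>
               (\<forall>th1 th2. is_solution m r T0 theta1 th1 \<longrightarrow> is_solution m r T0 theta2 th2 \<longrightarrow>
                   (\<forall>t\<in>{0..T0}. H_norm r (th1 t - th2 t) \<le> K0 * H_norm s (theta1 - theta2))))))"

end

theory Submission
  imports Defs "HOL-Real_Asymp.Real_Asymp"
begin

text \<open>
  Perturb the steady state \<open>- sin (a x_d)\<close> by \<open>\<epsilon>\<close> times a wave with horizontal frequency \<open>k'\<close>.
  Up to an error \<open>O(\<epsilon>\<^sup>2)\<close>, the modes \<open>(k', n a)\<close> of the perturbation solve a linear system
  \<open>z\<^sub>n' = p\<^sub>n z\<^sub>n\<^sub>-\<^sub>1 + q\<^sub>n z\<^sub>n\<^sub>+\<^sub>1\<close> with bounded coefficients that are nonnegative by positivity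
  of \<open>m\<^sub>d\<close>. Picard iteration therefore bounds the solution from below by any subsolution; the one
  supported on \<open>n = 1, 2\<close> grows at rate \<open>(a / 2) m\<^sub>d(k', 2 a)\<close>, and no eigenfunction is needed.
  A Lipschitz estimate would bound \<open>exp ((a / 2) m\<^sub>d(k', 2 a) T)\<close> by a constant times the \<open>H\<^sup>s\<close> norm
  of the wave, which is polynomial in \<open>|k'|\<close>. But a rational function tending to infinity along a
  line grows at least linearly there.
\<close>

subsection \<open>Growth of cooperative systems\<close>

text \<open>Nonnegative couplings preserve lower bounds under integration, so repeated substitution
  into the integral equation builds the Taylor sums of \<open>exp (\<sigma> * t)\<close> on top of
  the subsolution \<open>v\<close>. The defects \<open>D n\<close> may grow with \<open>n\<close>,
  hence the order of limits: first \<epsilon> to 0 at a fixed number of iterations, then infinitely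
  many iterations.\<close>

lemma cooperative_growth:
  fixes z F :: "real \<Rightarrow> int \<Rightarrow> real \<Rightarrow> real" and v p q D :: "int \<Rightarrow> real"
  assumes T: "T \<ge> 0" and e0: "\<epsilon>0 > 0"
    and bound: "\<And>\<epsilon> n t. \<lbrakk>0 < \<epsilon>; \<epsilon> \<le> \<epsilon>0; 0 \<le> t; t \<le> T\<rbrakk> \<Longrightarrow> \<bar>z \<epsilon> n t\<bar> \<le> M"
    and intble: "\<And>\<epsilon> n t. \<lbrakk>0 < \<epsilon>; \<epsilon> \<le> \<epsilon>0; 0 \<le> t; t \<le> T\<rbrakk> \<Longrightarrow> set_integrable lborel {0..t} (F \<epsilon> n)"
    and eq: "\<And>\<epsilon> n t. \<lbrakk>0 < \<epsilon>; \<epsilon> \<le> \<epsilon>0; 0 \<le> t; t \<le> T\<rbrakk> \<Longrightarrow>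
               z \<epsilon> n t = v n + (LINT s:{0..t}|lborel. F \<epsilon> n s)"
    and low: "\<And>\<epsilon> n t. \<lbrakk>0 < \<epsilon>; \<epsilon> \<le> \<epsilon>0; 0 \<le> t; t \<le> T\<rbrakk> \<Longrightarrow>
               F \<epsilon> n t \<ge> p n * z \<epsilon> (n - 1) t + q n * z \<epsilon> (n + 1) t - \<epsilon> * D n"
    and p: "\<And>n. p n \<ge> 0" and q: "\<And>n. q n \<ge> 0" and pq: "\<And>n. p n + q n \<le> b"
    and l: "\<sigma> \<ge> 0" and v: "\<And>n. v n \<ge> 0"
    and sub: "\<And>n. \<sigma> * v n \<le> p n * v (n - 1) + q n * v (n + 1)"
  shows "exp (\<sigma> * T) * v n \<le> M"
proof -
  \<comment> \<open>After \<open>N\<close> iterations \<open>g N\<close> multiplies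
    \<open>v\<close>, while \<open>M * h N\<close> is what remains of the a priori bound, each
    iteration costing a factor \<open>b\<close>. Since \<open>g 0 = 0\<close> and
    \<open>h 0 = 1\<close>, the start is the trivial bound \<open>z \<ge> - M\<close>.\<close>
  define g where "g N t = (\<Sum>j<N. (\<sigma> * t) ^ j / fact j)" for N :: nat and t :: real
  define h where "h N t = (b * t) ^ N / fact N" for N :: nat and t :: real
  have b0: "b \<ge> 0" using p[of 0] q[of 0] pq[of 0] by linarith
  have M0: "M \<ge> 0" using bound[of \<epsilon>0 0 0] T e0 by fastforce
  have g0: "g N t \<ge> 0" if "t \<ge> 0" for N t
    unfolding g_def using that l by (intro sum_nonneg) auto
  have h0: "h N t \<ge> 0" if "t \<ge> 0" for N t
    unfolding h_def using that b0 by auto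
  have dpow: "((\<lambda>t. (c * t) ^ Suc j / fact (Suc j)) has_real_derivative c * ((c * t) ^ j / fact j)) (at t)"
    for c t :: real and j :: nat
  proof -
    have "((\<lambda>t. (c * t) ^ Suc j / fact (Suc j)) has_real_derivative
            (real (Suc j) * (c * t) ^ j * c) / fact (Suc j)) (at t)"
      by (rule derivative_eq_intros refl | simp)+
    also have "(real (Suc j) * (c * t) ^ j * c) / fact (Suc j) = c * ((c * t) ^ j / fact j)"
      by (simp add: field_simps del: of_nat_Suc)
    finally show ?thesis .
  qed
  have gS: "g (Suc N) = (\<lambda>t. 1 + (\<Sum>j<N. (\<sigma> * t) ^ Suc j / fact (Suc j)))" for N
    unfolding g_def by (subst sum.lessThan_Suc_shift) simp
  have dg: "(g (Suc N) has_real_derivative \<sigma> * g N t) (at t)" for N t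
    unfolding gS unfolding g_def sum_distrib_left
    by (rule derivative_eq_intros dpow refl | simp)+
  have dh: "(h (Suc N) has_real_derivative b * h N t) (at t)" for N t
    unfolding h_def by (rule dpow)
  have cg: "isCont (g N) t" for N t unfolding g_def by (intro continuous_intros) auto
  have ch: "isCont (h N) t" for N t unfolding h_def by (intro continuous_intros) auto
  \<comment> \<open>The quantifiers matter: \<open>E\<close> depends on \<open>N\<close> and
    \<open>n\<close>, but on neither \<epsilon> nor \<open>t\<close>.\<close>
  have iter: "\<exists>E. \<forall>\<epsilon> t. 0 < \<epsilon> \<longrightarrow> \<epsilon> \<le> \<epsilon>0 \<longrightarrow> 0 \<le> t \<longrightarrow> t \<le> T \<longrightarrow>
                 z \<epsilon> n t \<ge> g N t * v n - M * h N t - \<epsilon> * E" for N n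
  proof (induction N arbitrary: n)
    case 0
    show ?case
    proof (intro exI[of _ 0] allI impI)
      fix \<epsilon> t assume "0 < \<epsilon>" "\<epsilon> \<le> \<epsilon>0" "0 \<le> t" "t \<le> T"
      with bound[of \<epsilon> t n] show "z \<epsilon> n t \<ge> g 0 t * v n - M * h 0 t - \<epsilon> * 0"
        by (simp add: g_def h_def)
    qed
  next
    case (Suc N)
    obtain E1 where E1: "\<And>\<epsilon> t. 0 < \<epsilon> \<Longrightarrow> \<epsilon> \<le> \<epsilon>0 \<Longrightarrow> 0 \<le> t \<Longrightarrow> t \<le> T \<Longrightarrow>
         z \<epsilon> (n - 1) t \<ge> g N t * v (n - 1) - M * h N t - \<epsilon> * E1"
      using Suc[of "n - 1"] by blast
    obtain E2 where E2: "\<And>\<epsilon> t. 0 < \<epsilon> \<Longrightarrow> \<epsilon> \<le> \<epsilon>0 \<Longrightarrow> 0 \<le> t \<Longrightarrow> t \<le> T \<Longrightarrow>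
         z \<epsilon> (n + 1) t \<ge> g N t * v (n + 1) - M * h N t - \<epsilon> * E2"
      using Suc[of "n + 1"] by blast
    define E where "E = \<bar>p n * E1 + q n * E2 + D n\<bar>"
    show ?case
    proof (intro exI[of _ "E * T"] allI impI)
      fix \<epsilon> t assume e: "0 < \<epsilon>" "\<epsilon> \<le> \<epsilon>0" and t: "0 \<le> t" "t \<le> T"
      \<comment> \<open>\<open>H\<close> is the lower bound for the integrand that the induction
        hypothesis gives, and \<open>HH\<close> its explicit primitive, whose value at 0 is the
        initial value \<open>v n\<close>.\<close>
      define H where "H s = \<sigma> * g N s * v n - M * (b * h N s) - \<epsilon> * E" for s
      define HH where "HH s = g (Suc N) s * v n - M * h (Suc N) s - \<epsilon> * E * s" for s
      have dHH: "(HH has_real_derivative H s) (at s)" for s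
        unfolding HH_def H_def by (rule derivative_eq_intros dg dh refl | simp)+
      have cH: "isCont H s" for s
        unfolding H_def by (intro continuous_intros cg ch)
      have "(\<integral>s. H s * indicator {0..t} s \<partial>lborel) = HH t - HH 0"
        by (rule integral_FTC_Icc_real) (use t dHH cH in auto)
      then have int_H: "(LINT s:{0..t}|lborel. H s) = HH t - HH 0"
        by (simp add: set_lebesgue_integral_def mult.commute)
      have iH: "set_integrable lborel {0..t} H"
        by (rule borel_integrable_atLeastAtMost')
          (auto intro!: continuous_at_imp_continuous_on cH)
      have le: "H s \<le> F \<epsilon> n s" if s: "s \<in> {0..t}" for s
      proof -
        have s': "0 \<le> s" "s \<le> T" using s t by auto
        have "p n * (g N s * v (n - 1) - M * h N s - \<epsilon> * E1) +
              q n * (g N s * v (n + 1) - M * h N s - \<epsilon> * E2) - \<epsilon> * D n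
              \<le> p n * z \<epsilon> (n - 1) s + q n * z \<epsilon> (n + 1) s - \<epsilon> * D n"
          using mult_left_mono[OF E1[OF e s'] p[of n]] mult_left_mono[OF E2[OF e s'] q[of n]]
          by linarith
        also have "\<dots> \<le> F \<epsilon> n s" by (rule low[OF e s'])
        finally have 1: "g N s * (p n * v (n - 1) + q n * v (n + 1)) - (p n + q n) * (M * h N s)
            - \<epsilon> * (p n * E1 + q n * E2 + D n) \<le> F \<epsilon> n s"
          by (simp add: algebra_simps)
        have 2: "g N s * (\<sigma> * v n) \<le> g N s * (p n * v (n - 1) + q n * v (n + 1))"
          by (intro mult_left_mono sub g0 s')
        have 3: "(p n + q n) * (M * h N s) \<le> b * (M * h N s)"
          by (intro mult_right_mono pq mult_nonneg_nonneg M0 h0 s')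
        have 4: "\<epsilon> * (p n * E1 + q n * E2 + D n) \<le> \<epsilon> * E"
          unfolding E_def using e by (intro mult_left_mono) auto
        show ?thesis using 1 2 3 4 unfolding H_def by (simp add: algebra_simps)
      qed
      have "HH t - HH 0 \<le> (LINT s:{0..t}|lborel. F \<epsilon> n s)"
        unfolding int_H[symmetric] by (rule set_integral_mono[OF iH intble[OF e t] le])
      moreover have "HH 0 = v n"
        unfolding HH_def gS h_def by simp
      moreover have "\<epsilon> * E * t \<le> \<epsilon> * (E * T)"
        using e t by (simp add: E_def mult_left_mono)
      ultimately show "z \<epsilon> n t \<ge> g (Suc N) t * v n - M * h (Suc N) t - \<epsilon> * (E * T)"
        unfolding eq[OF e t] HH_def by linarith
    qed
  qed
  \<comment> \<open>With \<open>N\<close> fixed, \<epsilon> tends to 0 and removes the term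
    \<open>\<epsilon> * E\<close>.\<close>
  have fin: "g N T * v n - M * h N T \<le> M" for N
  proof -
    obtain E where E: "\<And>\<epsilon>. 0 < \<epsilon> \<Longrightarrow> \<epsilon> \<le> \<epsilon>0 \<Longrightarrow> z \<epsilon> n T \<ge> g N T * v n - M * h N T - \<epsilon> * E"
      using iter[of N n] T by blast
    have lim: "((\<lambda>\<epsilon>. g N T * v n - M * h N T - \<epsilon> * E) \<longlongrightarrow> g N T * v n - M * h N T - 0 * E) (at_right 0)"
      by (intro tendsto_intros)
    have "eventually (\<lambda>\<epsilon>. g N T * v n - M * h N T - \<epsilon> * E \<le> M) (at_right 0)"
      using eventually_at_right_real[OF e0]
    proof eventually_elim
      case (elim \<epsilon>)
      then show ?case using E[of \<epsilon>] bound[of \<epsilon> T n] T by fastforce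
    qed
    from tendsto_upperbound[OF lim this] show ?thesis by simp
  qed
  have "(\<lambda>N. g N T) \<longlonglongrightarrow> exp (\<sigma> * T)"
    using exp_converges[of "\<sigma> * T"] unfolding sums_def g_def by (simp add: divide_inverse mult.commute)
  moreover have "(\<lambda>N. h N T) \<longlonglongrightarrow> 0"
    using summable_LIMSEQ_zero[OF summable_exp[of "b * T"]]
    unfolding h_def by (simp add: divide_inverse mult.commute)
  ultimately have "(\<lambda>N. g N T * v n - M * h N T) \<longlonglongrightarrow> exp (\<sigma> * T) * v n - M * 0"
    by (intro tendsto_intros)
  then show ?thesis
    using LIMSEQ_le_const2[of _ _ M] fin by fastforce
qed

subsection \<open>Rational functions along a line\<close>

lemma poly_divide_convergent_at_infinity:
  fixes p q :: "real poly"
  assumes "degree p \<le> degree q" "q \<noteq> 0"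
  shows "\<exists>L. ((\<lambda>x. poly p x / poly q x) \<longlongrightarrow> L) at_infinity"
proof (cases "degree p < degree q")
  case True
  then show ?thesis using poly_divide_tendsto_0_at_infinity by blast
next
  case False
  then have eq: "degree p = degree q" using assms by simp
  have "((\<lambda>x. (poly p x / x ^ degree p) / (poly q x / x ^ degree q)) \<longlongrightarrow> lead_coeff p / lead_coeff q) at_infinity"
    using assms by (intro tendsto_divide poly_divide_tendsto_aux) auto
  moreover have "eventually (\<lambda>x. (poly p x / x ^ degree p) / (poly q x / x ^ degree q) = poly p x / poly q x) at_infinity"
  proof (rule eventually_at_infinityI[of 1])
    fix x :: real assume "norm x \<ge> 1"
    then have "x ^ degree q \<noteq> 0" by auto
    then show "(poly p x / x ^ degree p) / (poly q x / x ^ degree q) = poly p x / poly q x"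
      unfolding eq by simp
  qed
  ultimately show ?thesis by (intro exI) (rule Lim_transform_eventually)
qed

text \<open>Divergence forces the degree of \<open>p\<close> above that of \<open>q\<close>, so
  \<open>x * q x / p x\<close> still has a finite limit; inverting its eventual bound gives the
  rate.\<close>

lemma poly_ratio_linear_growth:
  fixes p q :: "real poly"
  assumes lim: "filterlim (\<lambda>N::nat. poly p (real N) / poly q (real N)) at_top sequentially"
  shows "\<exists>c>0. eventually (\<lambda>N::nat. poly p (real N) / poly q (real N) \<ge> c * real N) sequentially"
proof -
  have inf: "filterlim (\<lambda>N::nat. real N) at_infinity sequentially"
    using filterlim_real_sequentially filterlim_at_top_imp_at_infinity by blast
  have pos: "eventually (\<lambda>N::nat. poly p (real N) / poly q (real N) > 0) sequentially"
    using lim unfolding filterlim_at_top_dense by blast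
  \<comment> \<open>Division by 0 yields 0, so a vanishing denominator contradicts eventual
    positivity just as a vanishing numerator does.\<close>
  have q0: "q \<noteq> 0"
  proof
    assume "q = 0"
    with pos show False by simp
  qed
  have p0: "p \<noteq> 0"
  proof
    assume "p = 0"
    with pos show False by simp
  qed
  have "degree p > degree q"
  proof (rule ccontr)
    assume "\<not> degree p > degree q"
    then obtain L where "((\<lambda>x. poly p x / poly q x) \<longlongrightarrow> L) at_infinity"
      using poly_divide_convergent_at_infinity[of p q] q0 by auto
    from filterlim_compose[OF this inf]
    have "(\<lambda>N. poly p (real N) / poly q (real N)) \<longlonglongrightarrow> L" .
    then show False
      using not_tendsto_and_filterlim_at_infinity[OF _ _ filterlim_at_top_imp_at_infinity[OF lim]]
      by simp
  qed
  \<comment> \<open>\<open>pCons 0 q\<close> is \<open>x * q x\<close>, of degree one more than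
    \<open>q\<close> and so at most that of \<open>p\<close>.\<close>
  then obtain L where "((\<lambda>x. poly (pCons 0 q) x / poly p x) \<longlongrightarrow> L) at_infinity"
    using poly_divide_convergent_at_infinity[of "pCons 0 q" p] p0 q0 by auto
  from filterlim_compose[OF this inf]
  have "(\<lambda>N. poly (pCons 0 q) (real N) / poly p (real N)) \<longlonglongrightarrow> L" .
  then have "eventually (\<lambda>N. poly (pCons 0 q) (real N) / poly p (real N) < \<bar>L\<bar> + 1) sequentially"
    by (rule order_tendstoD) simp
  with pos have "eventually (\<lambda>N::nat. poly p (real N) / poly q (real N) \<ge> 1 / (\<bar>L\<bar> + 1) * real N) sequentially"
  proof eventually_elim
    case (elim N)
    define f where "f = poly p (real N) / poly q (real N)"
    have f: "f > 0" using elim f_def by simp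
    have "real N / f < \<bar>L\<bar> + 1" using elim(2) by (simp add: f_def mult.commute)
    then have "real N \<le> (\<bar>L\<bar> + 1) * f" using f by (simp add: divide_simps split: if_splits)
    then show ?case unfolding f_def[symmetric] by (simp add: field_simps)
  qed
  then show ?thesis by (intro exI[of _ "1 / (\<bar>L\<bar> + 1)"]) auto
qed

lemma poly_fun_on_line:
  fixes P :: "'n::finite lattice \<Rightarrow> real"
  assumes "poly_fun P"
  shows "\<exists>p :: real poly. \<forall>N::nat. P (axis i (\<tau> * int N), b) = poly p (real N)"
proof -
  obtain A :: "((nat ^ 'n) \<times> nat) set" and coef where A: "finite A"
    "\<And>k. P k = (\<Sum>\<alpha>\<in>A. coef \<alpha> * (\<Prod>i\<in>UNIV. real_of_int (fst k $ i) ^ (fst \<alpha> $ i))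
                              * real_of_int (snd k) ^ snd \<alpha>)"
    using assms unfolding poly_fun_def by (elim exE conjE) (rule that, assumption, erule spec)
  \<comment> \<open>Coordinates other than \<open>i\<close> vanish on the line. Their factor is the
    zero polynomial to a power, and \<open>0 ^ 0 = 1\<close> keeps the monomials that do not contain
    them.\<close>
  define p where "p = (\<Sum>\<alpha>\<in>A. smult (coef \<alpha>)
      (\<Prod>j\<in>UNIV. (if j = i then [:0, real_of_int \<tau>:] else 0) ^ (fst \<alpha> $ j)) * [:real_of_int b ^ snd \<alpha>:])"
  have "P (axis i (\<tau> * int N), b) = poly p (real N)" for N :: nat
    unfolding A(2) p_def poly_sum
  proof (intro sum.cong refl)
    fix \<alpha> assume "\<alpha> \<in> A"
    have "(\<Prod>j\<in>UNIV. real_of_int (fst (axis i (\<tau> * int N), b) $ j) ^ (fst \<alpha> $ j)) =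
        poly (\<Prod>j\<in>UNIV. (if j = i then [:0, real_of_int \<tau>:] else 0) ^ (fst \<alpha> $ j)) (real N)"
      unfolding poly_prod by (intro prod.cong refl) (simp add: axis_def mult.commute)
    then show "coef \<alpha> * (\<Prod>j\<in>UNIV. real_of_int (fst (axis i (\<tau> * int N), b) $ j) ^ (fst \<alpha> $ j))
        * real_of_int (snd (axis i (\<tau> * int N), b)) ^ snd \<alpha> =
        poly (smult (coef \<alpha>) (\<Prod>j\<in>UNIV. (if j = i then [:0, real_of_int \<tau>:] else 0) ^ (fst \<alpha> $ j))
          * [:real_of_int b ^ snd \<alpha>:]) (real N)"
      by (simp only: poly_mult poly_smult poly_pCons poly_0 snd_conv) simp
  qed
  then show ?thesis by blast
qed

subsection \<open>Sobolev norms and the nonlinearity\<close>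

lemma sob_weight_ge_1: "s \<ge> 0 \<Longrightarrow> sob_weight s k \<ge> 1"
  unfolding sob_weight_def by (rule ge_one_powr_ge_zero) auto

lemma sob_weight_nonneg [simp]: "sob_weight s k \<ge> 0"
  unfolding sob_weight_def by simp

lemma H_norm_nonneg [simp]: "H_norm s c \<ge> 0"
  unfolding H_norm_def by (intro real_sqrt_ge_zero infsum_nonneg) auto

lemma H_norm_power2: "(H_norm s c)\<^sup>2 = (\<Sum>\<^sub>\<infinity>k. sob_weight s k * (cmod (c k))\<^sup>2)"
  unfolding H_norm_def by (intro real_sqrt_pow2 infsum_nonneg) auto

lemma in_H_finite_support:
  assumes "real_valued c" "finite {k. c k \<noteq> 0}"
  shows "in_H s c"
  unfolding in_H_def
  by (intro conjI assms finite_nonzero_values_imp_summable_on, rule finite_subset[OF _ assms(2)]) auto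

lemma cmod_add_power2_le: "(cmod (x + y))\<^sup>2 \<le> 2 * (cmod x)\<^sup>2 + 2 * (cmod y)\<^sup>2"
proof -
  have "(cmod (x + y))\<^sup>2 \<le> (cmod x + cmod y)\<^sup>2"
    by (intro power_mono norm_triangle_ineq) auto
  also have "\<dots> \<le> 2 * (cmod x)\<^sup>2 + 2 * (cmod y)\<^sup>2"
    using sum_squares_bound[of "cmod x" "cmod y"] by (simp add: power2_sum)
  finally show ?thesis .
qed

text \<open>The pointwise bound on squares stands in for the triangle inequality; a crude bound on
  the norm of the perturbed data is enough.\<close>

lemma in_H_add:
  assumes "in_H s c" "in_H s d"
  shows "in_H s (\<lambda>k. c k + d k)"
    and "(H_norm s (\<lambda>k. c k + d k))\<^sup>2 \<le> 2 * (H_norm s c)\<^sup>2 + 2 * (H_norm s d)\<^sup>2"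
proof -
  have sc: "(\<lambda>k. sob_weight s k * (cmod (c k))\<^sup>2) summable_on UNIV"
    and sd: "(\<lambda>k. sob_weight s k * (cmod (d k))\<^sup>2) summable_on UNIV"
    using assms unfolding in_H_def by auto
  let ?g = "\<lambda>k. 2 * (sob_weight s k * (cmod (c k))\<^sup>2) + 2 * (sob_weight s k * (cmod (d k))\<^sup>2)"
  have sg: "?g summable_on UNIV"
    by (intro summable_on_add summable_on_cmult_right sc sd)
  have le: "sob_weight s k * (cmod (c k + d k))\<^sup>2 \<le> ?g k" for k
    using mult_left_mono[OF cmod_add_power2_le[of "c k" "d k"] sob_weight_nonneg[of s k]]
    by (simp add: algebra_simps)
  have ss: "(\<lambda>k. sob_weight s k * (cmod (c k + d k))\<^sup>2) summable_on UNIV"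
    by (rule summable_on_comparison_test[OF sg le]) auto
  then show "in_H s (\<lambda>k. c k + d k)"
    using assms unfolding in_H_def real_valued_def by auto
  have "(H_norm s (\<lambda>k. c k + d k))\<^sup>2 \<le> (\<Sum>\<^sub>\<infinity>k. ?g k)"
    unfolding H_norm_power2 by (rule infsum_mono[OF ss sg le])
  also have "\<dots> = 2 * (H_norm s c)\<^sup>2 + 2 * (H_norm s d)\<^sup>2"
    unfolding H_norm_power2
    by (subst infsum_add) (auto intro!: summable_on_cmult_right sc sd simp: infsum_cmult_right')
  finally show "(H_norm s (\<lambda>k. c k + d k))\<^sup>2 \<le> 2 * (H_norm s c)\<^sup>2 + 2 * (H_norm s d)\<^sup>2" .
qed

lemma in_H_scale:
  assumes "in_H s c"
  shows "in_H s (\<lambda>k. complex_of_real x * c k)"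
proof -
  have eq: "sob_weight s k * (cmod (x * c k))\<^sup>2 = x\<^sup>2 * (sob_weight s k * (cmod (c k))\<^sup>2)" for k
    by (simp add: norm_mult power_mult_distrib)
  show ?thesis
    using assms unfolding in_H_def real_valued_def eq by (auto intro: summable_on_cmult_right)
qed

lemma H_norm_scale: "H_norm s (\<lambda>k. complex_of_real x * c k) = \<bar>x\<bar> * H_norm s c"
proof -
  have eq: "sob_weight s k * (cmod (x * c k))\<^sup>2 = x\<^sup>2 * (sob_weight s k * (cmod (c k))\<^sup>2)" for k
    by (simp add: norm_mult power_mult_distrib)
  show ?thesis
    unfolding H_norm_def eq infsum_cmult_right' by (simp add: real_sqrt_mult)
qed

lemma in_H_diff:
  assumes "in_H s c" "in_H s d"
  shows "in_H s (c - d)"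
proof -
  have "c - d = (\<lambda>k. c k + complex_of_real (-1) * d k)" by auto
  then show ?thesis using in_H_add(1)[OF assms(1) in_H_scale[OF assms(2)]] by metis
qed

text \<open>A single term of the norm, with weight at least 1. It carries the Lipschitz estimate
  over to individual Fourier modes.\<close>

lemma cmod_le_H_norm:
  assumes "in_H s c" "s \<ge> 0"
  shows "cmod (c k) \<le> H_norm s c"
proof -
  have "(cmod (c k))\<^sup>2 \<le> sob_weight s k * (cmod (c k))\<^sup>2"
    using mult_right_mono[OF sob_weight_ge_1[OF assms(2), of k], of "(cmod (c k))\<^sup>2"] by simp
  also have "\<dots> = (\<Sum>k\<in>{k}. sob_weight s k * (cmod (c k))\<^sup>2)" by simp
  also have "\<dots> \<le> (\<Sum>\<^sub>\<infinity>k. sob_weight s k * (cmod (c k))\<^sup>2)"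
    using assms(1) unfolding in_H_def by (intro finite_sum_le_infsum) auto
  finally show ?thesis
    unfolding H_norm_power2[symmetric] by (rule power2_le_imp_le) simp
qed

text \<open>The derivative falls on the output frequency \<open>k\<close>, and the symbol, of order
  \<open>r0 \<le> r\<close>, is absorbed by the weight on one factor. The nonlinearity is thus
  quadratic in the \<open>H^r\<close> norm, which makes the error second order in the perturbation;
  the constant may grow with \<open>k\<close>, as each mode is treated separately.\<close>

lemma nl_summand_bound:
  assumes "in_H r c" and r: "0 \<le> r0" "r0 \<le> r" and C: "C > 0"
    and m: "\<And>k. norm (m k) \<le> C * (1 + norm (rvec k)) powr r0"
  shows "nl_summand m c k summable_on UNIV"
    and "cmod (\<Sum>\<^sub>\<infinity>j. nl_summand m c k j) \<le> norm (rvec k) * C * (2 powr r0 + 1) * (H_norm r c)\<^sup>2"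
proof -
  let ?w = "\<lambda>j. sob_weight r j * (cmod (c j))\<^sup>2"
  let ?g = "\<lambda>j. norm (rvec k) * C * (2 powr r0 * ?w j + ?w (k - j))"
  have sw: "?w summable_on UNIV" using assms(1) unfolding in_H_def by auto
  have bij: "bij_betw (\<lambda>j. k - j) UNIV UNIV"
    by (rule bij_betw_byWitness[of _ "\<lambda>j. k - j"]) auto
  have sw': "(\<lambda>j. ?w (k - j)) summable_on UNIV"
    using summable_on_reindex_bij_betw[OF bij, of ?w] sw by simp
  have iw': "(\<Sum>\<^sub>\<infinity>j. ?w (k - j)) = (\<Sum>\<^sub>\<infinity>j. ?w j)"
    by (rule infsum_reindex_bij_betw[OF bij, of ?w])
  have sg: "?g summable_on UNIV"
    by (intro summable_on_cmult_right summable_on_add sw sw')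
  have le: "norm (nl_summand m c k j) \<le> ?g j" for j
  proof -
    \<comment> \<open>\<open>x\<close> is the factor that carries the symbol bound. Using
      \<open>x * y \<le> x\<^sup>2 + y\<^sup>2\<close> decouples the convolution into two sums that
      are each controlled by the norm.\<close>
    define x where "x = (1 + norm (rvec j)) powr r0 * cmod (c j)"
    define y where "y = cmod (c (k - j))"
    have "\<bar>inner (rvec k) (m j)\<bar> \<le> norm (rvec k) * (C * (1 + norm (rvec j)) powr r0)"
      by (rule order_trans[OF Cauchy_Schwarz_ineq2]) (intro mult_left_mono m, simp)
    then have "norm (nl_summand m c k j) \<le>
        (norm (rvec k) * (C * (1 + norm (rvec j)) powr r0)) * cmod (c j) * cmod (c (k - j))"
      unfolding nl_summand_def norm_mult norm_of_real by (intro mult_right_mono) auto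
    also have "\<dots> = norm (rvec k) * C * (x * y)"
      by (simp add: x_def y_def mult_ac)
    also have "\<dots> \<le> norm (rvec k) * C * (2 powr r0 * ?w j + ?w (k - j))"
    proof (intro mult_left_mono)
      have "2 * (x * y) \<le> x\<^sup>2 + y\<^sup>2" using sum_squares_bound[of x y] by simp
      moreover have "x * y \<ge> 0" by (simp add: x_def y_def)
      ultimately have "x * y \<le> x\<^sup>2 + y\<^sup>2" by linarith
      also have "x\<^sup>2 \<le> 2 powr r0 * ?w j"
      proof -
        have "((1 + norm (rvec j)) powr r0)\<^sup>2 = ((1 + norm (rvec j))\<^sup>2) powr r0"
          by (simp add: power2_eq_square powr_mult)
        also have "\<dots> \<le> (2 * (1 + (norm (rvec j))\<^sup>2)) powr r0"
          using sum_squares_bound[of 1 "norm (rvec j)"] r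
          by (intro powr_mono2) (auto simp: power2_sum)
        also have "\<dots> = 2 powr r0 * (1 + (norm (rvec j))\<^sup>2) powr r0"
          by (rule powr_mult)
        also have "\<dots> \<le> 2 powr r0 * sob_weight r j"
          unfolding sob_weight_def using r by (intro mult_left_mono powr_mono) auto
        finally have "((1 + norm (rvec j)) powr r0)\<^sup>2 \<le> 2 powr r0 * sob_weight r j" .
        from mult_right_mono[OF this, of "(cmod (c j))\<^sup>2"]
        show ?thesis by (simp add: x_def power_mult_distrib mult_ac)
      qed
      also have "y\<^sup>2 \<le> ?w (k - j)"
        using mult_right_mono[OF sob_weight_ge_1[of r "k - j"], of "y\<^sup>2"] r by (simp add: y_def)
      finally show "x * y \<le> 2 powr r0 * ?w j + ?w (k - j)" by simp
    qed (use C in auto)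
    finally show ?thesis .
  qed
  have abs: "(\<lambda>j. norm (nl_summand m c k j)) summable_on UNIV"
    by (rule summable_on_comparison_test[OF sg le]) auto
  then show sum: "nl_summand m c k summable_on UNIV" by (rule abs_summable_summable)
  have "cmod (\<Sum>\<^sub>\<infinity>j. nl_summand m c k j) \<le> (\<Sum>\<^sub>\<infinity>j. ?g j)"
    by (rule norm_infsum_le[OF has_sum_infsum[OF sum] has_sum_infsum[OF sg] le])
  also have "\<dots> = norm (rvec k) * C * (2 powr r0 * (\<Sum>\<^sub>\<infinity>j. ?w j) + (\<Sum>\<^sub>\<infinity>j. ?w j))"
    unfolding infsum_cmult_right'
    by (subst infsum_add) (auto intro!: summable_on_cmult_right sw sw' simp: infsum_cmult_right' iw')
  also have "\<dots> = norm (rvec k) * C * (2 powr r0 + 1) * (H_norm r c)\<^sup>2"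
    unfolding H_norm_power2 by (simp add: algebra_simps)
  finally show "cmod (\<Sum>\<^sub>\<infinity>j. nl_summand m c k j) \<le> norm (rvec k) * C * (2 powr r0 + 1) * (H_norm r c)\<^sup>2" .
qed

subsection \<open>Perturbations of the shear flow\<close>

text \<open>The Fourier coefficients of \<open>- sin (a x_d)\<close>. The minus sign makes the
  couplings between neighbouring modes of a perturbation nonnegative when \<open>m_d\<close>
  is.\<close>

definition shear :: "int \<Rightarrow> 'n::finite state" where
  "shear a k = (if k = (0, a) then \<i> / 2 else if k = (0, - a) then - \<i> / 2 else 0)"

text \<open>For \<open>k' \<noteq> 0\<close> and \<open>a > 0\<close> this is
  \<open>2 cos (k'.x' + a x_d) + 2 cos (k'.x' + 2 a x_d)\<close>: two adjacent modes that feed each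
  other, with the opposite frequencies added for real values.\<close>

definition wave :: "int ^ 'n \<Rightarrow> int \<Rightarrow> 'n::finite state" where
  "wave k' a k = (if k \<in> {(k', a), (- k', - a), (k', 2 * a), (- k', - 2 * a)} then 1 else 0)"

lemma shear_eq_0 [simp]: "fst k \<noteq> 0 \<Longrightarrow> shear a k = 0"
  unfolding shear_def by auto

lemma in_H_shear:
  assumes a: "a \<noteq> 0"
  shows "in_H s (shear a :: 'n::finite state)"
proof (rule in_H_finite_support)
  show "real_valued (shear a :: 'n state)"
    unfolding real_valued_def
  proof
    fix k :: "'n lattice"
    obtain x y where k: "k = (x, y)" by (cases k)
    have [simp]: "a \<noteq> - a" "- a \<noteq> a" using a by auto
    show "shear a (- k) = cnj (shear a k)"
      unfolding shear_def k using a by (auto simp: minus_equation_iff[of y])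
  qed
  show "finite {k :: 'n lattice. shear a k \<noteq> 0}"
    by (rule finite_subset[of _ "{(0, a), (0, - a)}"]) (auto simp: shear_def split: if_splits)
qed

lemma in_H_wave: "in_H s (wave k' a)"
proof (rule in_H_finite_support)
  show "real_valued (wave k' a)"
    unfolding real_valued_def
  proof
    fix k :: "'a lattice"
    obtain x y where k: "k = (x, y)" by (cases k)
    show "wave k' a (- k) = cnj (wave k' a k)"
      unfolding wave_def k by (auto simp: minus_equation_iff[of y] minus_equation_iff[of x])
  qed
  show "finite {k. wave k' a k \<noteq> 0}"
    by (rule finite_subset[of _ "{(k', a), (- k', - a), (k', 2 * a), (- k', - 2 * a)}"])
      (auto simp: wave_def split: if_splits)
qed

lemma norm_rvec_power2: "(norm (rvec (k', b)))\<^sup>2 = (norm (rvec (k', 0)))\<^sup>2 + (real_of_int b)\<^sup>2"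
  unfolding rvec_def by (simp add: norm_Pair)

lemma norm_rvec_minus: "norm (rvec (- k)) = norm (rvec k)"
proof -
  have "rvec (- k) = - rvec k" unfolding rvec_def by (auto simp: vec_eq_iff)
  then show ?thesis by simp
qed

lemma rvec_add: "rvec (j + k) = rvec j + rvec k"
  unfolding rvec_def by (auto simp: vec_eq_iff)

text \<open>At most four modes contribute, with vertical frequency at most \<open>2 * a\<close> in
  modulus, so the norm is polynomial in \<open>|k'|\<close>; the exponential has to beat it.\<close>

lemma H_norm_wave_le:
  assumes "s \<ge> 0"
  shows "H_norm s (wave k' a) \<le> sqrt (4 * (1 + 4 * (real_of_int a)\<^sup>2 + (norm (rvec (k', 0)))\<^sup>2) powr s)"
proof -
  let ?W = "{(k', a), (- k', - a), (k', 2 * a), (- k', - 2 * a)}"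
  let ?B = "(1 + 4 * (real_of_int a)\<^sup>2 + (norm (rvec (k', 0)))\<^sup>2) powr s"
  have "(\<Sum>\<^sub>\<infinity>k. sob_weight s k * (cmod (wave k' a k))\<^sup>2) = (\<Sum>\<^sub>\<infinity>k\<in>?W. sob_weight s k)"
    by (rule infsum_cong_neutral) (auto simp: wave_def)
  also have "\<dots> = (\<Sum>k\<in>?W. sob_weight s k)" by simp
  also have "\<dots> \<le> of_nat (card ?W) * ?B"
  proof (rule sum_bounded_above)
    fix k assume k: "k \<in> ?W"
    have m: "(norm (rvec (- k', - b)))\<^sup>2 = (norm (rvec (k', 0)))\<^sup>2 + (real_of_int b)\<^sup>2" for b
      using norm_rvec_minus[of "(k', b)"] norm_rvec_power2[of k' b] by simp
    have "(norm (rvec k))\<^sup>2 \<le> (norm (rvec (k', 0)))\<^sup>2 + (2 * real_of_int a)\<^sup>2"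
      using k m[of a] m[of "2 * a"] norm_rvec_power2[of k' a] norm_rvec_power2[of k' "2 * a"]
      by (auto simp: power_mult_distrib)
    then show "sob_weight s k \<le> ?B"
      unfolding sob_weight_def using assms by (intro powr_mono2) (auto simp: power_mult_distrib)
  qed
  also have "\<dots> \<le> 4 * ?B"
    by (intro mult_right_mono) (auto simp: card_insert_if)
  finally show ?thesis unfolding H_norm_def by simp
qed

text \<open>Two shear modes interact only at a vertical output frequency \<open>k\<close>, which
  sees the last component of \<open>m\<close> alone. That component vanishes at
  \<open>(0, a)\<close> and \<open>(0, - a)\<close>, even if \<open>m (0, - a)\<close> has a
  horizontal part.\<close>

lemma nl_summand_shear:
  assumes "m (0, a) = 0" "snd (m (0, - a)) = 0"
  shows "nl_summand m (shear a) k j = 0"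
proof (cases "shear a j = 0 \<or> shear a (k - j) = 0")
  case True
  then show ?thesis by (auto simp: nl_summand_def)
next
  case False
  then have "fst j = 0" "fst (k - j) = 0" using shear_eq_0 by metis+
  then have "fst k = 0" by simp
  moreover have "j = (0, a) \<or> j = (0, - a)" using False unfolding shear_def by presburger
  ultimately have "inner (rvec k) (m j) = 0"
    using assms by (auto simp: inner_prod_def rvec_def zero_vec_def[symmetric])
  then show ?thesis by (simp add: nl_summand_def)
qed

lemma is_solution_shear:
  assumes "m (0, a) = 0" "snd (m (0, - a)) = 0" "a \<noteq> 0"
  shows "is_solution m r T (shear a) (\<lambda>_. shear a)"
proof -
  have n: "nl_summand m (shear a) k = (\<lambda>_. 0)" for k
    by (rule ext) (rule nl_summand_shear[OF assms(1,2)])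
  have n': "nonlin m (shear a) k = 0" for k
    unfolding nonlin_def n by simp
  show ?thesis
    unfolding is_solution_def n n'
    by (auto simp: in_H_shear[OF assms(3)] set_integrable_def set_lebesgue_integral_def)
qed

text \<open>Linearization about the shear flow on the column over \<open>k'\<close>: the shear
  couples a mode only to its two vertical neighbours, and what is left is quadratic in
  \<open>d\<close>.\<close>

lemma nonlin_shear_add:
  fixes m :: "'n::finite lattice \<Rightarrow> (real ^ 'n) \<times> real" and d :: "'n state"
  assumes div_free: "\<And>k. inner (rvec k) (m k) = 0"
    and m: "m (0, a) = 0" "snd (m (0, - a)) = 0" and a: "a \<noteq> 0" and k': "k' \<noteq> 0"
    and sum: "nl_summand m d (k', b) summable_on UNIV"
  shows "nonlin m (\<lambda>j. shear a j + d j) (k', b) =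
    complex_of_real (- (a / 2)) * (snd (m (k', b - a)) * d (k', b - a) + snd (m (k', b + a)) * d (k', b + a))
    + inner (fst (rvec (k', 0))) (fst (m (0, - a))) / 2 * d (k', b + a)
    + \<i> * (\<Sum>\<^sub>\<infinity>j. nl_summand m d (k', b) j)"
proof -
  let ?k = "(k', b)"
  \<comment> \<open>A cross term survives only if \<open>j\<close> or \<open>?k - j\<close> is one
    of the two shear frequencies.\<close>
  let ?X = "{(0, a), (0, - a), (k', b - a), (k', b + a)}"
  define f where "f j = complex_of_real (inner (rvec ?k) (m j)) *
      (shear a j * d (?k - j) + d j * shear a (?k - j))" for j
  have split: "nl_summand m (\<lambda>j. shear a j + d j) ?k j = nl_summand m d ?k j + f j" for j
  proof -
    \<comment> \<open>As \<open>k' \<noteq> 0\<close>, the frequencies \<open>j\<close> and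
      \<open>?k - j\<close> cannot both be vertical.\<close>
    have "shear a j * shear a (?k - j) = 0"
      using k' by (cases "fst j = 0") auto
    then show ?thesis
      unfolding nl_summand_def f_def by (auto simp: algebra_simps)
  qed
  have f0: "f j = 0" if "j \<notin> ?X" for j
  proof -
    have "shear a j = 0" using that by (auto simp: shear_def)
    moreover have "shear a (?k - j) = 0"
    proof -
      have "?k - j \<noteq> (0, a)" "?k - j \<noteq> (0, - a)" using that by (cases j; force)+
      then show ?thesis by (simp add: shear_def)
    qed
    ultimately show ?thesis by (simp add: f_def)
  qed
  have sf: "f summable_on UNIV"
    by (rule finite_nonzero_values_imp_summable_on, rule finite_subset[of _ ?X]) (use f0 in blast, simp)
  have "(\<Sum>\<^sub>\<infinity>j. f j) = (\<Sum>\<^sub>\<infinity>j\<in>?X. f j)"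
    by (rule infsum_cong_neutral) (use f0 in blast)+
  also have "\<dots> = f (0, a) + f (0, - a) + f (k', b - a) + f (k', b + a)"
    using a k' by (simp add: add.assoc)
  finally have isf: "(\<Sum>\<^sub>\<infinity>j. f j) = f (0, a) + f (0, - a) + f (k', b - a) + f (k', b + a)" .
  \<comment> \<open>Here \<open>?k\<close> is \<open>j + (0, a)\<close> with \<open>j\<close> the
    frequency in \<open>m j\<close>; since \<open>j\<close> is orthogonal to \<open>m j\<close>,
    only the vertical shift contributes.\<close>
  have in1: "inner (rvec ?k) (m (k', b - a)) = a * snd (m (k', b - a))"
  proof -
    have "rvec ?k = rvec (k', b - a) + rvec (0, a)" unfolding rvec_add[symmetric] by simp
    then show ?thesis using div_free
      by (simp add: inner_add_left) (simp add: inner_prod_def rvec_def zero_vec_def[symmetric])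
  qed
  have in2: "inner (rvec ?k) (m (k', b + a)) = - a * snd (m (k', b + a))"
  proof -
    have "rvec ?k = rvec (k', b + a) + rvec (0, - a)" unfolding rvec_add[symmetric] by simp
    then show ?thesis using div_free
      by (simp add: inner_add_left) (simp add: inner_prod_def rvec_def zero_vec_def[symmetric])
  qed
  have in3: "inner (rvec ?k) (m (0, - a)) = inner (fst (rvec (k', 0))) (fst (m (0, - a)))"
    using m by (simp add: inner_prod_def rvec_def)
  have aa: "a \<noteq> - a" "- a \<noteq> a" using a by auto
  have fs: "f (0, a) = 0"
    "f (0, - a) = inner (fst (rvec (k', 0))) (fst (m (0, - a))) * (- \<i> / 2 * d (k', b + a))"
    "f (k', b - a) = a * snd (m (k', b - a)) * (d (k', b - a) * (\<i> / 2))"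
    "f (k', b + a) = - a * snd (m (k', b + a)) * (d (k', b + a) * (- \<i> / 2))"
    unfolding f_def in1 in2 in3 using m k' aa by (simp_all add: shear_def)
  have "nonlin m (\<lambda>j. shear a j + d j) ?k = \<i> * ((\<Sum>\<^sub>\<infinity>j. nl_summand m d ?k j) + (\<Sum>\<^sub>\<infinity>j. f j))"
    unfolding nonlin_def split by (subst infsum_add[OF sum sf]) simp
  also have "\<dots> = complex_of_real (- (a / 2)) * (snd (m (k', b - a)) * d (k', b - a) + snd (m (k', b + a)) * d (k', b + a))
    + inner (fst (rvec (k', 0))) (fst (m (0, - a))) / 2 * d (k', b + a)
    + \<i> * (\<Sum>\<^sub>\<infinity>j. nl_summand m d ?k j)"
    unfolding isf fs by (simp add: algebra_simps)
  finally show ?thesis .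
qed

section \<open>Exponential growth of a perturbation of the shear flow\<close>

lemma set_integral_Re_scale:
  fixes f :: "real \<Rightarrow> complex" and x :: real
  assumes "set_integrable M A f"
  shows "set_integrable M A (\<lambda>s. x * Re (f s))"
    and "(LINT s:A|M. x * Re (f s)) = x * Re (LINT s:A|M. f s)"
proof -
  have bl: "bounded_linear (\<lambda>z. x * Re z)"
    by (intro bounded_linear_const_mult bounded_linear_Re)
  have eq: "(\<lambda>s. indicat_real A s *\<^sub>R (x * Re (f s))) = (\<lambda>s. x * Re (indicat_real A s *\<^sub>R f s))"
    by auto
  show "set_integrable M A (\<lambda>s. x * Re (f s))"
    using integrable_bounded_linear[OF bl] assms unfolding set_integrable_def eq by blast
  show "(LINT s:A|M. x * Re (f s)) = x * Re (LINT s:A|M. f s)"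
    using integral_bounded_linear[OF bl] assms
    unfolding set_integrable_def set_lebesgue_integral_def eq by blast
qed

text \<open>
  Only \<open>m\<^sub>d\<close> is assumed even, so \<open>m (0, - a)\<close> may have a horizontal part although \<open>m (0, a) = 0\<close>.
  It contributes the coefficient \<open>- k' . m'(0, - a) / 2\<close> of \<open>z\<^sub>n\<^sub>+\<^sub>1\<close>, which the assumption
  \<open>drift\<close> makes nonnegative; replacing \<open>k'\<close> by \<open>- k'\<close> achieves this.
\<close>
lemma perturbation_growth:
  fixes m :: "'n::finite lattice \<Rightarrow> (real ^ 'n) \<times> real" and a :: int
  assumes div_free: "\<And>k. inner (rvec k) (m k) = 0"
    and m: "m (0, a) = 0" "snd (m (0, - a)) = 0" and a: "a > 0" and k': "k' \<noteq> 0"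
    and r: "0 \<le> r0" "r0 \<le> r" and C: "C > 0"
    and mC: "\<And>k. norm (m k) \<le> C * (1 + norm (rvec k)) powr r0"
    and pos: "\<And>n. snd (m (k', n * a)) \<ge> 0" and ub: "\<And>n. snd (m (k', n * a)) \<le> B"
    and dec: "snd (m (k', 2 * a)) \<le> snd (m (k', a))"
    and drift: "inner (fst (rvec (k', 0))) (fst (m (0, - a))) \<le> 0"
    and T: "T \<ge> 0" and e0: "\<epsilon>0 > 0"
    and sol: "\<And>\<epsilon>. 0 < \<epsilon> \<Longrightarrow> \<epsilon> \<le> \<epsilon>0 \<Longrightarrow>
               is_solution m r T (\<lambda>k. shear a k + complex_of_real \<epsilon> * wave k' a k) (th \<epsilon>)"
    and bd: "\<And>\<epsilon> t. 0 < \<epsilon> \<Longrightarrow> \<epsilon> \<le> \<epsilon>0 \<Longrightarrow> 0 \<le> t \<Longrightarrow> t \<le> T \<Longrightarrow>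
               H_norm r (th \<epsilon> t - shear a) \<le> \<epsilon> * M"
  shows "exp (a / 2 * snd (m (k', 2 * a)) * T) \<le> M"
proof -
  define \<mu> where "\<mu> n = snd (m (k', n * a))" for n
  define \<kappa> where "\<kappa> = inner (fst (rvec (k', 0))) (fst (m (0, - a)))"
  define v :: "int \<Rightarrow> real" where "v n = (if n = 1 \<or> n = 2 then 1 else 0)" for n
  \<comment> \<open>The constant of \<open>nl_summand_bound\<close> with norm
    \<open>\<epsilon> * M\<close>, after \<open>\<epsilon>\<^sup>2\<close> is taken out.\<close>
  define D where "D n = norm (rvec (k', n * a)) * C * (2 powr r0 + 1) * M\<^sup>2" for n
  define p where "p n = a / 2 * \<mu> (n - 1)" for n
  define q where "q n = a / 2 * \<mu> (n + 1) - \<kappa> / 2" for n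
  have r0: "r \<ge> 0" using r by simp
  have a0: "a \<noteq> 0" using a by simp
  have \<mu>0: "\<mu> n \<ge> 0" and \<mu>B: "\<mu> n \<le> B" for n
    using pos ub by (auto simp: \<mu>_def)
  have \<kappa>0: "\<kappa> \<le> 0" using drift by (simp add: \<kappa>_def)
  have inH: "in_H r (th \<epsilon> t)" if "0 < \<epsilon>" "\<epsilon> \<le> \<epsilon>0" "0 \<le> t" "t \<le> T" for \<epsilon> t
    using sol[of \<epsilon>] that unfolding is_solution_def by auto
  have inHd: "in_H r (th \<epsilon> t - shear a)" if "0 < \<epsilon>" "\<epsilon> \<le> \<epsilon>0" "0 \<le> t" "t \<le> T" for \<epsilon> t
    by (rule in_H_diff[OF inH[OF that] in_H_shear[OF a0]])
  have th_d: "(th \<epsilon> t - shear a) (k', b) = th \<epsilon> t (k', b)" for \<epsilon> t b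
    using k' by simp
  have wv: "wave k' a (k', n * a) = v n" for n
  proof -
    \<comment> \<open>The opposite frequencies of the wave therefore lie off the column over
      \<open>k'\<close>.\<close>
    have "k' \<noteq> - k'"
    proof
      assume "k' = - k'"
      then have "\<forall>i. k' $ i = - k' $ i" by (metis vector_uminus_component)
      then show False using k' by (auto simp: vec_eq_iff)
    qed
    moreover have "n * a = a \<longleftrightarrow> n = 1" "n * a = 2 * a \<longleftrightarrow> n = 2" using a by auto
    ultimately show ?thesis unfolding wave_def v_def by auto
  qed
  \<comment> \<open>Divided by \<epsilon>, the modes start from \<open>v\<close> for every
    \<epsilon> and, by the Lipschitz bound, stay within \<open>M\<close>; the growth is read off at
    \<open>n = 1\<close>.\<close>
  have "exp ((a / 2 * \<mu> 2) * T) * v 1 \<le> M"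
  proof (rule cooperative_growth[where z = "\<lambda>\<epsilon> n t. Re (th \<epsilon> t (k', n * a)) / \<epsilon>"
        and F = "\<lambda>\<epsilon> n s. (- 1 / \<epsilon>) * Re (nonlin m (th \<epsilon> s) (k', n * a))"
        and p = p and q = q and D = D and b = "a / 2 * B + (a / 2 * B - \<kappa> / 2)", OF T e0])
    fix \<epsilon> t :: real and n :: int
    assume e: "0 < \<epsilon>" "\<epsilon> \<le> \<epsilon>0" and t: "0 \<le> t" "t \<le> T"
    have "\<bar>Re (th \<epsilon> t (k', n * a))\<bar> \<le> cmod ((th \<epsilon> t - shear a) (k', n * a))"
      unfolding th_d by (rule abs_Re_le_cmod)
    also have "\<dots> \<le> H_norm r (th \<epsilon> t - shear a)"
      by (rule cmod_le_H_norm[OF inHd[OF e t] r0])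
    also have "\<dots> \<le> \<epsilon> * M" by (rule bd[OF e t])
    finally show "\<bar>Re (th \<epsilon> t (k', n * a)) / \<epsilon>\<bar> \<le> M"
      using e by (simp add: field_simps)
    have *: "set_integrable lborel {0..t} (\<lambda>s. nonlin m (th \<epsilon> s) (k', n * a))"
      "th \<epsilon> t (k', n * a) = shear a (k', n * a) + complex_of_real \<epsilon> * wave k' a (k', n * a)
         - (LINT s:{0..t}|lborel. nonlin m (th \<epsilon> s) (k', n * a))"
      using sol[OF e] t unfolding is_solution_def by auto
    show "set_integrable lborel {0..t} (\<lambda>s. (- 1 / \<epsilon>) * Re (nonlin m (th \<epsilon> s) (k', n * a)))"
      by (rule set_integral_Re_scale[OF *(1)])
    show "Re (th \<epsilon> t (k', n * a)) / \<epsilon> =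
        v n + (LINT s:{0..t}|lborel. (- 1 / \<epsilon>) * Re (nonlin m (th \<epsilon> s) (k', n * a)))"
      unfolding set_integral_Re_scale(2)[OF *(1)] unfolding *(2) wv
      using e k' by (simp add: field_simps)
    define d where "d = th \<epsilon> t - shear a"
    have nls: "nl_summand m d (k', n * a) summable_on UNIV"
      and nlb: "cmod (\<Sum>\<^sub>\<infinity>j. nl_summand m d (k', n * a) j)
         \<le> norm (rvec (k', n * a)) * C * (2 powr r0 + 1) * (H_norm r d)\<^sup>2"
      unfolding d_def using nl_summand_bound[OF inHd[OF e t] r C mC] by auto
    define R where "R = Re (\<i> * (\<Sum>\<^sub>\<infinity>j. nl_summand m d (k', n * a) j))"
    have th: "th \<epsilon> t = (\<lambda>j. shear a j + d j)" by (auto simp: d_def)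
    have dd: "d (k', b) = th \<epsilon> t (k', b)" for b unfolding d_def by (rule th_d)
    have idx: "n * a - a = (n - 1) * a" "n * a + a = (n + 1) * a" by (auto simp: algebra_simps)
    have "Re (nonlin m (th \<epsilon> t) (k', n * a)) =
        - (p n * Re (th \<epsilon> t (k', (n - 1) * a)) + q n * Re (th \<epsilon> t (k', (n + 1) * a))) + R"
      unfolding nonlin_shear_add[OF div_free m a0 k' nls, folded th] R_def idx \<kappa>_def[symmetric]
        dd p_def q_def \<mu>_def
      by (simp add: algebra_simps)
    \<comment> \<open>Division by \<epsilon> will leave the defect \<open>\<epsilon> * D n\<close>
      that the comparison allows.\<close>
    moreover have "R \<le> \<epsilon>\<^sup>2 * D n"
    proof -
      have "R \<le> cmod (\<i> * (\<Sum>\<^sub>\<infinity>j. nl_summand m d (k', n * a) j))"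
        unfolding R_def by (rule complex_Re_le_cmod)
      also have "\<dots> \<le> norm (rvec (k', n * a)) * C * (2 powr r0 + 1) * (H_norm r d)\<^sup>2"
        using nlb by (simp add: norm_mult)
      also have "\<dots> \<le> norm (rvec (k', n * a)) * C * (2 powr r0 + 1) * (\<epsilon> * M)\<^sup>2"
        using bd[OF e t] C unfolding d_def[symmetric]
        by (intro mult_left_mono power_mono) auto
      also have "\<dots> = \<epsilon>\<^sup>2 * D n" by (simp add: D_def power_mult_distrib)
      finally show ?thesis .
    qed
    ultimately have "- Re (nonlin m (th \<epsilon> t) (k', n * a)) \<ge>
        p n * Re (th \<epsilon> t (k', (n - 1) * a)) + q n * Re (th \<epsilon> t (k', (n + 1) * a)) - \<epsilon>\<^sup>2 * D n"
      by linarith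
    then have "(- Re (nonlin m (th \<epsilon> t) (k', n * a))) / \<epsilon> \<ge>
        (p n * Re (th \<epsilon> t (k', (n - 1) * a)) + q n * Re (th \<epsilon> t (k', (n + 1) * a)) - \<epsilon>\<^sup>2 * D n) / \<epsilon>"
      using e by (intro divide_right_mono) auto
    then show "p n * (Re (th \<epsilon> t (k', (n - 1) * a)) / \<epsilon>) + q n * (Re (th \<epsilon> t (k', (n + 1) * a)) / \<epsilon>) - \<epsilon> * D n
        \<le> - 1 / \<epsilon> * Re (nonlin m (th \<epsilon> t) (k', n * a))"
      using e by (simp add: diff_divide_distrib add_divide_distrib power2_eq_square)
  next
    fix n :: int
    show p0: "p n \<ge> 0" unfolding p_def using a \<mu>0 by simp
    show q0: "q n \<ge> 0" unfolding q_def using mult_nonneg_nonneg[of "a / 2" "\<mu> (n + 1)"] a \<mu>0[of "n + 1"] \<kappa>0 by linarith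
    have "a / 2 * \<mu> (n - 1) \<le> a / 2 * B" "a / 2 * \<mu> (n + 1) \<le> a / 2 * B"
      using a \<mu>B by (intro mult_left_mono; simp)+
    then show "p n + q n \<le> a / 2 * B + (a / 2 * B - \<kappa> / 2)"
      unfolding p_def q_def by linarith
    show "v n \<ge> 0" by (simp add: v_def)
    \<comment> \<open>Subsolution check: mode 1 is fed by mode 2 through \<open>q 1\<close>, which
      is at least \<open>a / 2 * \<mu> 2\<close>; mode 2 is fed by mode 1 through
      \<open>p 2 = a / 2 * \<mu> 1\<close>, where monotonicity enters. At other \<open>n\<close> the
      left side is 0.\<close>
    have "a / 2 * \<mu> 2 \<le> a / 2 * \<mu> 1"
      using a dec by (intro mult_left_mono) (auto simp: \<mu>_def)
    then show "a / 2 * \<mu> 2 * v n \<le> p n * v (n - 1) + q n * v (n + 1)"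
      using p0 q0 \<kappa>0 by (auto simp: v_def p_def q_def)
  next
    show "0 \<le> a / 2 * \<mu> 2" using a \<mu>0 by simp
  qed
  then show ?thesis by (simp add: v_def \<mu>_def)
qed

section \<open>Contradiction with Lipschitz well-posedness\<close>

lemma exp_beats_powr:
  fixes A c K s :: real
  assumes "c > 0" "A > 0" "s > 0" "K > 0"
  shows "\<exists>N0. \<forall>N\<ge>N0. K * sqrt (4 * (A + (real N)\<^sup>2) powr s) < exp (c * real N)"
proof -
  have "eventually (\<lambda>N::nat. K * sqrt (4 * (A + (real N)\<^sup>2) powr s) < exp (c * real N)) sequentially"
    using assms by real_asymp
  then show ?thesis unfolding eventually_sequentially .
qed

lemma is_solution_mono:
  assumes "is_solution m r T c th" "T' \<le> T"
  shows "is_solution m r T' c th"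
proof -
  have "{0..T'} \<subseteq> {0..T}" using assms(2) by auto
  then show ?thesis
    using assms(1) unfolding is_solution_def
    by (elim conjE exE, intro conjI exI ballI allI) blast+
qed

text \<open>The point is that \<open>T\<close> and \<open>K\<close> do not depend on
  \<open>k'\<close>. The amplitude is scaled down until all perturbed data lie in one ball of
  \<open>H^s\<close>, and monotonicity of the time and the constant then gives common
  values.\<close>

lemma wellposed_growth_bound:
  fixes m :: "'n::finite lattice \<Rightarrow> (real ^ 'n) \<times> real" and a :: int
  assumes wp: "lip_wellposed m r s"
    and div_free: "\<And>k. inner (rvec k) (m k) = 0"
    and m: "m (0, a) = 0" "snd (m (0, - a)) = 0" and a: "a > 0"
    and r: "0 \<le> r0" "r0 \<le> r" and C: "C > 0"
    and mC: "\<And>k. norm (m k) \<le> C * (1 + norm (rvec k)) powr r0"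
  obtains T K where "T > 0" "K > 0"
    "\<And>k' B. \<lbrakk>k' \<noteq> 0; \<And>n. snd (m (k', n * a)) \<ge> 0; \<And>n. snd (m (k', n * a)) \<le> B;
        snd (m (k', 2 * a)) \<le> snd (m (k', a));
        inner (fst (rvec (k', 0))) (fst (m (0, - a))) \<le> 0\<rbrakk> \<Longrightarrow>
      exp (a / 2 * snd (m (k', 2 * a)) * T) \<le> K * H_norm s (wave k' a)"
proof -
  have a0: "a \<noteq> 0" using a by simp
  obtain T K :: "real \<Rightarrow> real \<Rightarrow> real" where
    TK: "\<forall>x\<ge>0. \<forall>y\<ge>0. T x y > 0 \<and> K x y > 0"
    and mono: "\<forall>x x' y y'. 0 \<le> x \<longrightarrow> x \<le> x' \<longrightarrow> 0 \<le> y \<longrightarrow> y \<le> y' \<longrightarrow> T x' y' \<le> T x y \<and> K x y \<le> K x' y'"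
    and wp': "\<forall>theta1 theta2 :: 'n state. in_H s theta1 \<longrightarrow> in_H s theta2 \<longrightarrow>
      (let T0 = T (H_norm s theta1) (H_norm s theta2); K0 = K (H_norm s theta1) (H_norm s theta2)
       in (\<exists>th1. is_solution m r T0 theta1 th1 \<and>
             (\<forall>th. is_solution m r T0 theta1 th \<longrightarrow> (\<forall>t\<in>{0..T0}. th t = th1 t))) \<and>
          (\<exists>th2. is_solution m r T0 theta2 th2 \<and>
             (\<forall>th. is_solution m r T0 theta2 th \<longrightarrow> (\<forall>t\<in>{0..T0}. th t = th2 t))) \<and>
          (\<forall>th1 th2. is_solution m r T0 theta1 th1 \<longrightarrow> is_solution m r T0 theta2 th2 \<longrightarrow>
             (\<forall>t\<in>{0..T0}. H_norm r (th1 t - th2 t) \<le> K0 * H_norm s (theta1 - theta2))))"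
    using wp unfolding lip_wellposed_def by (elim exE conjE) (rule that)
  have ex: "\<exists>th. is_solution m r (T (H_norm s c) (H_norm s d)) c th"
    if "in_H s c" "in_H s d" for c d :: "'n state"
    using wp'[rule_format, OF that] unfolding Let_def by (elim conjE exE) (rule exI)
  have lip: "H_norm r (th1 t - th2 t) \<le> K (H_norm s c) (H_norm s d) * H_norm s (c - d)"
    if "in_H s c" "in_H s d"
      "is_solution m r (T (H_norm s c) (H_norm s d)) c th1"
      "is_solution m r (T (H_norm s c) (H_norm s d)) d th2"
      "t \<in> {0..T (H_norm s c) (H_norm s d)}" for c d :: "'n state" and th1 th2 t
    using wp'[rule_format, OF that(1,2)] that(3-5) unfolding Let_def by (elim conjE) simp
  define S where "S = (shear a :: 'n state)"
  \<comment> \<open>The bound of \<open>in_H_add\<close> for the shear plus a perturbation of norm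
    at most 1.\<close>
  define R where "R = sqrt (2 * (H_norm s S)\<^sup>2 + 2)"
  define T0 where "T0 = T R (H_norm s S)"
  define K0 where "K0 = K R (H_norm s S)"
  have R0: "R \<ge> 0" by (simp add: R_def)
  have S: "in_H s S" unfolding S_def by (rule in_H_shear[OF a0])
  have pos: "T0 > 0" "K0 > 0" using TK R0 by (auto simp: T0_def K0_def)
  have "exp (a / 2 * snd (m (k', 2 * a)) * T0) \<le> K0 * H_norm s (wave k' a)"
    if k': "k' \<noteq> 0" and mu: "\<And>n. snd (m (k', n * a)) \<ge> 0" "\<And>n. snd (m (k', n * a)) \<le> B"
        "snd (m (k', 2 * a)) \<le> snd (m (k', a))"
      and drift: "inner (fst (rvec (k', 0))) (fst (m (0, - a))) \<le> 0" for k' B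
  proof -
    let ?W = "wave k' a"
    define c where "c \<epsilon> = (\<lambda>k. S k + complex_of_real \<epsilon> * ?W k)" for \<epsilon>
    \<comment> \<open>Keeps \<open>\<epsilon> * H_norm s ?W\<close> at most 1; the added 1 keeps the
      denominator positive.\<close>
    define \<epsilon>0 where "\<epsilon>0 = 1 / (1 + H_norm s ?W)"
    have d0: "1 + H_norm s ?W > 0" using H_norm_nonneg[of s ?W] by linarith
    then have e0: "\<epsilon>0 > 0" unfolding \<epsilon>0_def by simp
    have c: "in_H s (c \<epsilon>)" for \<epsilon>
      unfolding c_def by (intro in_H_add(1) S in_H_scale in_H_wave)
    have cR: "H_norm s (c \<epsilon>) \<le> R" if e: "0 < \<epsilon>" "\<epsilon> \<le> \<epsilon>0" for \<epsilon>
    proof -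
      have "\<epsilon> * H_norm s ?W \<le> \<epsilon>0 * (1 + H_norm s ?W)"
        using e by (intro mult_mono) auto
      also have "\<dots> = 1" using d0 by (simp add: \<epsilon>0_def)
      finally have "(\<epsilon> * H_norm s ?W)\<^sup>2 \<le> 1"
        using e by (intro power_le_one) auto
      moreover have "(H_norm s (c \<epsilon>))\<^sup>2 \<le> 2 * (H_norm s S)\<^sup>2 + 2 * (H_norm s (\<lambda>k. complex_of_real \<epsilon> * ?W k))\<^sup>2"
        unfolding c_def by (intro in_H_add(2) S in_H_scale in_H_wave)
      ultimately have "(H_norm s (c \<epsilon>))\<^sup>2 \<le> 2 * (H_norm s S)\<^sup>2 + 2"
        using e unfolding H_norm_scale by simp
      then show ?thesis unfolding R_def by (rule real_le_rsqrt)
    qed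
    have "\<forall>\<epsilon>. \<exists>th. is_solution m r (T (H_norm s (c \<epsilon>)) (H_norm s S)) (c \<epsilon>) th"
      using ex[OF c S] by blast
    then obtain th where th: "\<And>\<epsilon>. is_solution m r (T (H_norm s (c \<epsilon>)) (H_norm s S)) (c \<epsilon>) (th \<epsilon>)"
      by metis
    have TT: "T0 \<le> T (H_norm s (c \<epsilon>)) (H_norm s S)" and KK: "K (H_norm s (c \<epsilon>)) (H_norm s S) \<le> K0"
      if "0 < \<epsilon>" "\<epsilon> \<le> \<epsilon>0" for \<epsilon>
      using mono[rule_format, OF _ cR[OF that], of "H_norm s S" "H_norm s S"] by (auto simp: T0_def K0_def)
    have sol: "is_solution m r T0 (\<lambda>k. shear a k + complex_of_real \<epsilon> * wave k' a k) (th \<epsilon>)"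
      if "0 < \<epsilon>" "\<epsilon> \<le> \<epsilon>0" for \<epsilon>
      using is_solution_mono[OF th TT[OF that]] unfolding c_def S_def .
    \<comment> \<open>The perturbed solution is compared with the stationary shear. Their data
      differ by \<epsilon> times the wave, so \<open>M\<close> becomes
      \<open>K0 * H_norm s ?W\<close>.\<close>
    have bd: "H_norm r (th \<epsilon> t - shear a) \<le> \<epsilon> * (K0 * H_norm s ?W)"
      if e: "0 < \<epsilon>" "\<epsilon> \<le> \<epsilon>0" and t: "0 \<le> t" "t \<le> T0" for \<epsilon> t
    proof -
      have "H_norm r (th \<epsilon> t - (\<lambda>_. S) t) \<le> K (H_norm s (c \<epsilon>)) (H_norm s S) * H_norm s (c \<epsilon> - S)"
        by (rule lip[OF c S th]) (use is_solution_shear[OF m a0] t TT[OF e] in \<open>auto simp: S_def\<close>)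
      also have "c \<epsilon> - S = (\<lambda>k. complex_of_real \<epsilon> * ?W k)" by (auto simp: c_def)
      also have "H_norm s \<dots> = \<epsilon> * H_norm s ?W" using e by (simp add: H_norm_scale)
      also have "K (H_norm s (c \<epsilon>)) (H_norm s S) * (\<epsilon> * H_norm s ?W) \<le> K0 * (\<epsilon> * H_norm s ?W)"
        using KK[OF e] e by (intro mult_right_mono) auto
      finally show ?thesis unfolding S_def by (simp only: mult_ac)
    qed
    show ?thesis
      by (rule perturbation_growth[OF div_free m a k' r C mC mu drift _ e0 sol bd])
        (use pos in auto)
  qed
  with pos show thesis by (rule that)
qed

theorem theorem2p6:
  fixes m :: "'n::finite lattice \<Rightarrow> (real ^ 'n) \<times> real"
    and a :: int and r0 C r s :: real
  assumes div_free: "\<forall>k. inner (rvec k) (m k) = 0"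
    and a_pos: "a > 0"
    and h1: "m (0, a) = 0"
    and h2_rat: "\<exists>P Q. poly_fun P \<and> poly_fun Q \<and>
                   (\<forall>k. k \<noteq> 0 \<longrightarrow> Q k \<noteq> 0 \<and> snd (m k) = P k / Q k)"
    and h2_pos: "\<forall>k. fst k \<noteq> 0 \<longrightarrow> snd (m k) > 0"
    and h2_even: "\<forall>k. snd (m (- k)) = snd (m k)"
    and h3: "\<forall>n::nat. n \<ge> 1 \<longrightarrow>
               (\<forall>B. \<exists>R. \<forall>k'. norm (rvec (k', 0)) \<ge> R \<longrightarrow> snd (m (k', int n * a)) \<ge> B)"
    and h4: "\<forall>k'. k' \<noteq> 0 \<longrightarrow> (\<lambda>n::nat. snd (m (k', int n * a))) \<longlonglongrightarrow> 0"
    and h5: "\<forall>k'. k' \<noteq> 0 \<longrightarrow> (\<forall>n::nat. n \<ge> 1 \<longrightarrow>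
               snd (m (k', int (n + 1) * a)) < snd (m (k', int n * a)))"
    and h6: "r0 \<ge> 0" "C > 0" "\<forall>k. norm (m k) \<le> C * (1 + norm (rvec k)) powr r0"
    and hr: "r > max 2 r0"
    and hs: "s \<ge> r + 1"
  shows "\<not> lip_wellposed m r s"
proof
  assume wp: "lip_wellposed m r s"
  have m0: "snd (m (0, - a)) = 0"
    using h2_even[rule_format, of "(0, a)"] h1 by simp
  obtain T K where T: "T > 0" and K: "K > 0" and growth:
    "\<And>k' B. \<lbrakk>k' \<noteq> 0; \<And>n. snd (m (k', n * a)) \<ge> 0; \<And>n. snd (m (k', n * a)) \<le> B;
        snd (m (k', 2 * a)) \<le> snd (m (k', a));
        inner (fst (rvec (k', 0))) (fst (m (0, - a))) \<le> 0\<rbrakk> \<Longrightarrow>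
      exp (a / 2 * snd (m (k', 2 * a)) * T) \<le> K * H_norm s (wave k' a)"
    by (rule wellposed_growth_bound[OF wp _ h1 m0 a_pos h6(1) _ h6(2)])
      (use div_free h6(3) hr in auto)
  \<comment> \<open>The horizontal frequencies run along one axis, so that \<open>m_d\<close>
    becomes a rational function of the single variable \<open>N\<close>. The direction on that axis
    is set by \<tau>, opposite to the sign of \<open>w\<close>, which gives the drift the required
    sign.\<close>
  fix i :: 'n
  define w where "w = fst (m (0, - a)) $ i"
  define \<tau> :: int where "\<tau> = (if w \<le> 0 then 1 else - 1)"
  define k' :: "nat \<Rightarrow> int ^ 'n" where "k' N = axis i (\<tau> * int N)" for N
  have rk: "fst (rvec (k' N, 0)) = axis i (real_of_int \<tau> * real N)" for N
    unfolding rvec_def k'_def by (auto simp: vec_eq_iff axis_def)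
  have nk: "norm (rvec (k' N, 0)) = real N" for N
  proof -
    have "norm (rvec (k' N, 0)) = norm (fst (rvec (k' N, 0)))"
      unfolding rvec_def by (simp add: norm_Pair)
    then show ?thesis unfolding rk by (simp add: norm_eq_sqrt_inner inner_axis_axis \<tau>_def)
  qed
  have drift: "inner (fst (rvec (k' N, 0))) (fst (m (0, - a))) \<le> 0" for N
    unfolding rk inner_commute[of "axis _ _"] inner_axis w_def[symmetric]
    by (auto simp: \<tau>_def mult_nonpos_nonneg)
  have k0: "k' N \<noteq> 0" if "N \<ge> 1" for N
    using that by (auto simp: k'_def axis_eq_0_iff \<tau>_def)
  have bnd: "\<exists>B. \<forall>n::nat. snd (m (x, int n * a)) \<le> B" if "x \<noteq> 0" for x
    using Bseq_bdd_above[OF convergent_imp_Bseq[OF convergentI[OF h4[rule_format, OF that]]]]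
    unfolding bdd_above_def by auto
  have exp_le: "exp (a / 2 * snd (m (k' N, 2 * a)) * T) \<le> K * H_norm s (wave (k' N) a)" if N: "N \<ge> 1" for N
  proof -
    obtain B1 where B1: "\<And>n::nat. snd (m (k' N, int n * a)) \<le> B1" using bnd[OF k0[OF N]] by blast
    \<comment> \<open>The decay hypothesis concerns only \<open>n \<ge> 0\<close>. Evenness turns
      \<open>(k' N, n * a)\<close> with negative \<open>n\<close> into a point of the column over
      \<open>- k' N\<close>, which therefore needs its own bound.\<close>
    obtain B2 where B2: "\<And>n::nat. snd (m (- k' N, int n * a)) \<le> B2" using bnd[of "- k' N"] k0[OF N] by auto
    have ub: "snd (m (k' N, n * a)) \<le> max B1 B2" for n
    proof (cases "n \<ge> 0")
      case True
      then show ?thesis using B1[of "nat n"] by auto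
    next
      case False
      then show ?thesis
        using B2[of "nat (- n)"] h2_even[rule_format, of "(k' N, n * a)"] by auto
    qed
    show ?thesis
    proof (rule growth[OF k0[OF N] _ ub _ drift])
      show "snd (m (k' N, n * a)) \<ge> 0" for n
        using h2_pos[rule_format, of "(k' N, n * a)"] k0[OF N] by simp
      show "snd (m (k' N, 2 * a)) \<le> snd (m (k' N, a))"
        using h5[rule_format, OF k0[OF N], of 1] by simp
    qed
  qed
  obtain P Q where PQ: "poly_fun P" "poly_fun Q" "\<And>k. k \<noteq> 0 \<Longrightarrow> snd (m k) = P k / Q k"
    using h2_rat by blast
  obtain p q :: "real poly" where
    "\<And>N. P (k' N, 2 * a) = poly p (real N)" "\<And>N. Q (k' N, 2 * a) = poly q (real N)"
    using poly_fun_on_line[OF PQ(1)] poly_fun_on_line[OF PQ(2)] unfolding k'_def by metis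
  \<comment> \<open>Since \<open>2 * a \<noteq> 0\<close>, the lattice vector is nonzero for all
    \<open>N\<close>, including \<open>N = 0\<close>.\<close>
  then have mpq: "snd (m (k' N, 2 * a)) = poly p (real N) / poly q (real N)" for N
    using PQ(3)[of "(k' N, 2 * a)"] a_pos by (simp add: zero_prod_def)
  have "filterlim (\<lambda>N. poly p (real N) / poly q (real N)) at_top sequentially"
    unfolding filterlim_at_top
  proof
    fix Z :: real
    obtain R where R: "\<And>k'. norm (rvec (k', 0)) \<ge> R \<Longrightarrow> snd (m (k', int 2 * a)) \<ge> Z"
      using h3[rule_format, of 2 Z] by auto
    show "eventually (\<lambda>N. Z \<le> poly p (real N) / poly q (real N)) sequentially"
      using eventually_ge_at_top[of "nat \<lceil>R\<rceil>"]
    proof eventually_elim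
      case (elim N)
      then have "norm (rvec (k' N, 0)) \<ge> R" unfolding nk by linarith
      from R[OF this] show ?case by (simp add: mpq)
    qed
  qed
  then obtain c N1 where c: "c > 0" and N1: "\<And>N. N \<ge> N1 \<Longrightarrow> snd (m (k' N, 2 * a)) \<ge> c * real N"
    using poly_ratio_linear_growth[of p q] unfolding eventually_sequentially mpq by blast
  \<comment> \<open>Linear growth of \<open>m_d\<close> turns the exponent into this constant times
    \<open>N\<close>, while the wave norm stays polynomial in \<open>N\<close>.\<close>
  have "c * a / 2 * T > 0" using c a_pos T by simp
  then obtain N2 where N2: "\<And>N. N \<ge> N2 \<Longrightarrow>
      K * sqrt (4 * ((1 + 4 * (real_of_int a)\<^sup>2) + (real N)\<^sup>2) powr s) < exp (c * a / 2 * T * real N)"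
    using exp_beats_powr[of "c * a / 2 * T" "1 + 4 * (real_of_int a)\<^sup>2" s K] hr hs K
    by (auto simp: add_pos_nonneg)
  define N where "N = Max {1, N1, N2}"
  have N: "N \<ge> 1" "N \<ge> N1" "N \<ge> N2" by (auto simp: N_def)
  have "exp (c * a / 2 * T * real N) = exp (a / 2 * (c * real N) * T)" by (simp add: mult_ac)
  also have "\<dots> \<le> exp (a / 2 * snd (m (k' N, 2 * a)) * T)"
    unfolding exp_le_cancel_iff using N1[OF N(2)] a_pos T by (intro mult_right_mono mult_left_mono) auto
  also have "\<dots> \<le> K * H_norm s (wave (k' N) a)" by (rule exp_le[OF N(1)])
  also have "\<dots> \<le> K * sqrt (4 * (1 + 4 * (real_of_int a)\<^sup>2 + (real N)\<^sup>2) powr s)"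
    using H_norm_wave_le[of s "k' N" a] hr hs K unfolding nk by (intro mult_left_mono) auto
  also have "\<dots> < exp (c * a / 2 * T * real N)" by (rule N2[OF N(3)])
  finally show False by simp
qed

end
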